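(* Let $d$ be an integer larger than $1$ and let $n>d$ be an integer. Let $e_d'(n)$ be the minimum number of edges of a graph of order $n$ whose rainbow vertex connection number equals $d$. Then $e_d'(n)=n-1$. Moreover, for a connected graph $G$ of order $n$, one has $rvc(G)=d$ and $e(G)=n-1$ if and only if deleting all leaves of $G$ results in a tree of order $d$.
   Context: All graphs are undirected, finite and simple; $e(G)$ denotes the number of edges of $G$. A leaf is a vertex of degree $1$. Vertex-colorings are arbitrary: adjacent vertices may receive the same color. A path in a vertex-colored graph is a rainbow path if no two of its internal vertices have the same color. The rainbow vertex connection number $rvc(G)$ of a connected graph $G$ is the minimum integer $i$ for which there exists a vertex-coloring of $G$ with $i$ colors such that every two distinct vertices of $G$ are connected by a rainbow path. For natural numbers $d<n$, $\mathcal{G}'_d(n)$ denotes the set of all graphs of order $n$ with rainbow vertex connection number $d$, and $e_d'(n)=\min\{e(G) : G\in\mathcal{G}'_d(n)\}$.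
   Formalization: The claim e_d'(n)=n-1 is asserted only for n ≥ d+2, because for n=d+1 no graph of order n has rainbow vertex connection number d (e.g. d=2, n=3), so the minimum does not exist; the equivalence is kept for all n>d. *)

theory Defs
  imports Main
begin

(* An undirected graph is a vertex set together with a set of edges, each edge being the
   set of its two end vertices. *)
datatype 'a ugraph = UGraph (verts: "'a set") (edges: "'a set set")

definition simple_graph :: "'a ugraph \<Rightarrow> bool" where
  "simple_graph G \<longleftrightarrow> finite (verts G) \<and> (\<forall>e \<in> edges G. e \<subseteq> verts G \<and> card e = 2)"

definition order :: "'a ugraph \<Rightarrow> nat" where
  "order G = card (verts G)"

definition num_edges :: "'a ugraph \<Rightarrow> nat" where
  "num_edges G = card (edges G)"

definition degree :: "'a ugraph \<Rightarrow> 'a \<Rightarrow> nat" where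
  "degree G v = card {e \<in> edges G. v \<in> e}"

definition leaves :: "'a ugraph \<Rightarrow> 'a set" where
  "leaves G = {v \<in> verts G. degree G v = 1}"

definition delete_verts :: "'a ugraph \<Rightarrow> 'a set \<Rightarrow> 'a ugraph" where
  "delete_verts G S = UGraph (verts G - S) {e \<in> edges G. e \<inter> S = {}}"

(* Paths are nonempty lists of distinct, consecutively adjacent vertices. *)
definition is_path :: "'a ugraph \<Rightarrow> 'a list \<Rightarrow> bool" where
  "is_path G p \<longleftrightarrow> p \<noteq> [] \<and> distinct p \<and> set p \<subseteq> verts G \<and>
     (\<forall>i. Suc i < length p \<longrightarrow> {p ! i, p ! Suc i} \<in> edges G)"

definition path_between :: "'a ugraph \<Rightarrow> 'a \<Rightarrow> 'a list \<Rightarrow> 'a \<Rightarrow> bool" where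
  "path_between G u p v \<longleftrightarrow> is_path G p \<and> hd p = u \<and> last p = v"

definition connected_graph :: "'a ugraph \<Rightarrow> bool" where
  "connected_graph G \<longleftrightarrow> verts G \<noteq> {} \<and>
     (\<forall>u \<in> verts G. \<forall>v \<in> verts G. \<exists>p. path_between G u p v)"

definition is_cycle :: "'a ugraph \<Rightarrow> 'a list \<Rightarrow> bool" where
  "is_cycle G p \<longleftrightarrow> is_path G p \<and> 3 \<le> length p \<and> {last p, hd p} \<in> edges G"

definition is_tree :: "'a ugraph \<Rightarrow> bool" where
  "is_tree G \<longleftrightarrow> simple_graph G \<and> connected_graph G \<and> (\<nexists>p. is_cycle G p)"

definition internal_verts :: "'a list \<Rightarrow> 'a set" where
  "internal_verts p = set (butlast (tl p))"

(* Since paths have distinct vertices, injectivity of the colouring on the internal vertices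
   says that no two of them have the same colour. *)
definition rainbow_path :: "'a ugraph \<Rightarrow> ('a \<Rightarrow> nat) \<Rightarrow> 'a \<Rightarrow> 'a list \<Rightarrow> 'a \<Rightarrow> bool" where
  "rainbow_path G c u p v \<longleftrightarrow> path_between G u p v \<and> inj_on c (internal_verts p)"

definition rainbow_vertex_connected :: "'a ugraph \<Rightarrow> ('a \<Rightarrow> nat) \<Rightarrow> bool" where
  "rainbow_vertex_connected G c \<longleftrightarrow>
     (\<forall>u \<in> verts G. \<forall>v \<in> verts G. u \<noteq> v \<longrightarrow> (\<exists>p. rainbow_path G c u p v))"

(* Only meaningful for connected G: otherwise no colouring qualifies. With this convention a
   nonempty complete graph has value 1, as any colouring of it uses at least one colour. *)
definition rvc :: "'a ugraph \<Rightarrow> nat" where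
  "rvc G = (LEAST i. \<exists>c. c ` verts G \<subseteq> {..<i} \<and> rainbow_vertex_connected G c)"

(* Every finite graph is isomorphic to one with vertices in nat. *)
definition graphs_rvc :: "nat \<Rightarrow> nat \<Rightarrow> nat ugraph set" where
  "graphs_rvc d n =
     {G. simple_graph G \<and> connected_graph G \<and> order G = n \<and> rvc G = d}"

(* Inf of a nonempty set of naturals is its minimum, while Inf {} = 0; a positive value of
   min_edges is therefore attained by some graph.
   For 2 <= d the set graphs_rvc d (d + 1) is empty: a spanning tree of a connected graph of
   order n >= 3 has at most n - 2 non-leaves, and giving these distinct colours (and the
   leaves any of the same colours) makes all tree paths rainbow, so rvc is at most n - 2. *)
definition min_edges :: "nat \<Rightarrow> nat \<Rightarrow> nat" where
  "min_edges d n = Inf (num_edges ` graphs_rvc d n)"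

end

theory Submission
  imports Defs
begin

text \<open>
  An internal vertex of a path, like a vertex of a cycle, is never a leaf. Hence colouring the
  non-leaves injectively makes every path rainbow, and a connected graph is a tree iff it remains
  one when its leaves are deleted. In a tree, the path joining two distinct non-leaves extends at
  both ends to a path in which both are internal; since paths in trees are unique, a rainbow
  colouring separates them. So the rainbow vertex connection number of a tree with \<open>d \<ge> 1\<close>
  non-leaves is \<open>d\<close>.

  For the edge counts, fix a root and join every other vertex to a neighbour closer to the root.
  These edges are pairwise distinct, so a connected graph of order \<open>n\<close> has at least \<open>n - 1\<close> of
  them, and they exhaust all edges exactly when there is no cycle.
\<close>

section \<open>Paths and cycles\<close>

lemma is_path_iff:
  "is_path G p \<longleftrightarrow> p \<noteq> [] \<and> distinct p \<and> set p \<subseteq> verts G \<and>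
     successively (\<lambda>x y. {x, y} \<in> edges G) p"
  unfolding is_path_def successively_conv_nth by auto

lemma is_path_rev: "is_path G (rev p) \<longleftrightarrow> is_path G p"
  by (simp add: is_path_iff successively_rev insert_commute)

lemma is_path_Cons:
  "is_path G (x # p) \<longleftrightarrow> x \<in> verts G \<and>
     (p = [] \<or> x \<notin> set p \<and> {x, hd p} \<in> edges G \<and> is_path G p)"
  by (auto simp: is_path_iff successively_Cons)

lemma is_path_prefix: "is_path G (p @ q) \<Longrightarrow> p \<noteq> [] \<Longrightarrow> is_path G p"
  by (auto simp: is_path_iff successively_append_iff)

lemma is_path_suffix: "is_path G (p @ q) \<Longrightarrow> q \<noteq> [] \<Longrightarrow> is_path G q"
  by (auto simp: is_path_iff successively_append_iff)

lemma simple_graph_edgeD: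
  assumes "simple_graph G" "{x, y} \<in> edges G"
  shows "x \<in> verts G" "y \<in> verts G" "x \<noteq> y"
  using assms by (auto simp: simple_graph_def)

lemma finite_edges:
  assumes "simple_graph G"
  shows "finite (edges G)"
proof -
  have "edges G \<subseteq> Pow (verts G)" "finite (verts G)"
    using assms by (auto simp: simple_graph_def)
  then show ?thesis by (meson finite_Pow_iff finite_subset)
qed

lemma path_split_neighbours:
  assumes "is_path G (p @ v # q)" "p \<noteq> []" "q \<noteq> []"
  shows "{v, last p} \<in> edges G" "{v, hd q} \<in> edges G" "last p \<noteq> hd q"
proof -
  show "{v, last p} \<in> edges G" "{v, hd q} \<in> edges G"
    using assms by (auto simp: is_path_iff successively_append_iff successively_Cons insert_commute)
  have "set p \<inter> set q = {}" using assms by (auto simp: is_path_iff)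
  then show "last p \<noteq> hd q" using assms(2,3) by (metis disjoint_iff hd_in_set last_in_set)
qed

text \<open>The predecessor and the successor of \<open>v\<close> on the path serve; two distinct
  neighbours are what a leaf cannot have.\<close>

lemma internal_vertex_neighbours:
  assumes "is_path G p" "v \<in> internal_verts p"
  obtains a b where "{v, a} \<in> edges G" "{v, b} \<in> edges G" "a \<noteq> b"
proof -
  obtain x p' where p: "p = x # p'" using assms(1) by (cases p) (auto simp: is_path_def)
  then obtain m y where p': "p' = m @ [y]"
    using assms(2) by (cases p' rule: rev_cases) (auto simp: internal_verts_def)
  then have "v \<in> set m" using assms(2) p by (simp add: internal_verts_def)
  then obtain s t where "m = s @ v # t" by (meson split_list)
  then have "is_path G ((x # s) @ v # (t @ [y]))" using assms(1) p p' by simp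
  from path_split_neighbours[OF this] show thesis using that by blast
qed

text \<open>The end vertices of the list need separate cases, since one of their neighbours comes
  from the closing edge. That \<open>a\<close> and \<open>b\<close> lie on the cycle matters later,
  when \<open>v\<close> is chosen extremal among its vertices.\<close>

lemma cycle_vertex_neighbours:
  assumes "is_cycle G p" "v \<in> set p"
  obtains a b where "a \<in> set p" "b \<in> set p" "{v, a} \<in> edges G" "{v, b} \<in> edges G" "a \<noteq> b"
proof -
  have path: "is_path G p" and len: "3 \<le> length p" and closing: "{last p, hd p} \<in> edges G"
    using assms(1) by (auto simp: is_cycle_def)
  obtain s t where p: "p = s @ v # t" using assms(2) by (meson split_list)
  consider "s = []" | "t = []" | "s \<noteq> []" "t \<noteq> []" by blast
  then show thesis
  proof cases
    case 1
    then obtain b t' where t: "t = b # t'" using len p by (cases t) auto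
    then have t': "t' \<noteq> []" using len p 1 by auto
    have "{v, last t'} \<in> edges G" using closing p t t' 1 by (simp add: insert_commute)
    moreover have "{v, b} \<in> edges G" using path p t 1 by (simp add: is_path_iff)
    moreover have "b \<noteq> last t'" using path p t t' 1 by (auto simp: is_path_iff)
    ultimately show thesis using that[of "last t'" b] p t t' by auto
  next
    case 2
    then obtain b s' where s: "s = s' @ [b]" using len p by (cases s rule: rev_cases) auto
    then have s': "s' \<noteq> []" using len p 2 by auto
    have "{v, hd s'} \<in> edges G" using closing p s s' 2 by simp
    moreover have "{v, b} \<in> edges G"
      using path p s 2 by (simp add: is_path_iff successively_append_iff insert_commute)
    moreover have "b \<noteq> hd s'" using path p s s' 2 by (auto simp: is_path_iff)
    ultimately show thesis using that[of "hd s'" b] p s s' by auto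
  next
    case 3
    then show thesis
      using path_split_neighbours[of G s v t] path p that[of "last s" "hd t"] by auto
  qed
qed

text \<open>Either \<open>y\<close> is new and can be appended, or the path is cut off at
  \<open>y\<close>. This follows an edge without leaving the realm of paths with distinct
  vertices.\<close>

lemma path_snoc_or_prefix:
  assumes "path_between G u p x" "{x, y} \<in> edges G" "y \<in> verts G"
  obtains q where "path_between G u q y"
proof (cases "y \<in> set p")
  case True
  then obtain s t where p: "p = s @ y # t" by (meson split_list)
  have "is_path G ((s @ [y]) @ t)" using assms(1) p by (simp add: path_between_def)
  then have "is_path G (s @ [y])" by (rule is_path_prefix) simp
  moreover have "hd (s @ [y]) = u" using assms(1) p by (cases s) (auto simp: path_between_def)
  ultimately show thesis using that[of "s @ [y]"] by (simp add: path_between_def)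
next
  case False
  then have "path_between G u (p @ [y]) y"
    using assms by (auto simp: path_between_def is_path_iff successively_append_iff)
  then show thesis using that by blast
qed

lemma path_between_two_vertices:
  assumes "path_between G u p v" "u \<noteq> v"
  obtains a q where "p = u # a # q"
proof -
  obtain q where q: "p = u # q" using assms by (cases p) (auto simp: path_between_def is_path_def)
  moreover obtain a q' where "q = a # q'"
    using assms q by (cases q) (auto simp: path_between_def)
  ultimately show thesis using that by blast
qed

lemma path_between_rev: "path_between G u p v \<Longrightarrow> path_between G v (rev p) u"
  by (auto simp: path_between_def is_path_rev hd_rev last_rev)

text \<open>The first vertex at which the two paths meet again closes a cycle.\<close>

lemma cycle_from_diverging_paths:
  assumes "is_path G (u # p)" "is_path G (u # q)" "p \<noteq> []" "q \<noteq> []"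
    and "hd p \<noteq> hd q" "last p = last q"
  shows "\<exists>r. is_cycle G r"
proof -
  have "\<exists>x\<in>set p. x \<in> set q" using assms(3,4,6) last_in_set by metis
  then obtain s x p' where p: "p = s @ x # p'" and x: "x \<in> set q" and s: "\<forall>y\<in>set s. y \<notin> set q"
    by (rule split_list_first_propE) blast
  obtain t q' where q: "q = t @ x # q'" using x by (meson split_list)
  have "is_path G ((u # s @ [x]) @ p')" using assms(1) p by simp
  then have P: "is_path G (u # s @ [x])" by (rule is_path_prefix) simp
  have "is_path G ((u # t @ [x]) @ q')" using assms(2) q by simp
  then have Q: "is_path G (u # t @ [x])" by (rule is_path_prefix) simp
  \<comment> \<open>If both were empty, \<open>x\<close> would be the first vertex of
    \<open>p\<close> and of \<open>q\<close>. This gives the cycle its third vertex.\<close>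
  have ne: "s \<noteq> [] \<or> t \<noteq> []" using assms(5) p q by auto
  have "set s \<inter> set t = {}" using s q by auto
  \<comment> \<open>The cycle goes from \<open>u\<close> through \<open>s\<close> to
    \<open>x\<close> and returns to \<open>u\<close> along the reverse of \<open>t\<close>.\<close>
  moreover have Q': "is_path G ((x # rev t) @ [u])" using Q is_path_rev[of G "u # t @ [x]"] by simp
  ultimately have "is_path G ((u # s) @ (x # rev t))"
    using P is_path_prefix[OF Q']
    unfolding append_Cons[symmetric] is_path_iff successively_append_iff by auto
  moreover have "{last (x # rev t), u} \<in> edges G"
    using Q' unfolding is_path_iff successively_append_iff by simp
  moreover have "3 \<le> length ((u # s) @ (x # rev t))" using ne by (cases s; cases t) auto
  ultimately have "is_cycle G ((u # s) @ (x # rev t))" by (simp add: is_cycle_def)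
  then show ?thesis by blast
qed

text \<open>Common first vertices are stripped one by one; at the first disagreement the two paths
  diverge and meet again at \<open>v\<close>, which would produce a cycle.\<close>

lemma unique_path:
  assumes "\<nexists>r. is_cycle G r" "path_between G u p v" "path_between G u q v"
  shows "p = q"
  using assms(2,3)
proof (induction p arbitrary: u q)
  case Nil
  then show ?case by (simp add: path_between_def is_path_def)
next
  case (Cons x p)
  from Cons.prems have x: "x = u" by (simp add: path_between_def)
  from Cons.prems obtain q' where q: "q = u # q'"
    by (cases q) (auto simp: path_between_def is_path_def)
  have P: "is_path G (u # p)" "last (u # p) = v" and Q: "is_path G (u # q')" "last (u # q') = v"
    using Cons.prems x q by (auto simp: path_between_def)
  \<comment> \<open>If one path stops at once, then \<open>u = v\<close>, and distinctness keeps the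
    other from returning to \<open>u\<close>.\<close>
  have empty: "p = [] \<longleftrightarrow> q' = []"
    using P Q last_in_set[of p] last_in_set[of q'] by (auto simp: is_path_iff split: if_splits)
  show ?case
  proof (cases "p = []")
    case True
    then show ?thesis using empty x q by simp
  next
    case False
    then have q': "q' \<noteq> []" using empty by simp
    then have "hd p = hd q'"
      using cycle_from_diverging_paths[OF P(1) Q(1) False] P Q False assms(1) by auto
    then have "path_between G (hd p) p v" "path_between G (hd p) q' v"
      using P Q False q' by (auto simp: path_between_def is_path_Cons)
    then have "p = q'" by (rule Cons.IH)
    then show ?thesis using x q by simp
  qed
qed

text \<open>If \<open>z\<close> were on the path, the segment from \<open>x\<close> to
  \<open>z\<close> together with the edge back to \<open>x\<close> would be a cycle;
  \<open>z \<noteq> y\<close> makes it long enough.\<close>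

lemma extend_path:
  assumes "\<nexists>r. is_cycle G r" "is_path G (x # y # p)" "{x, z} \<in> edges G" "z \<in> verts G"
    and "z \<noteq> x" "z \<noteq> y"
  shows "is_path G (z # x # y # p)"
proof -
  have "z \<notin> set p"
  proof
    assume "z \<in> set p"
    then obtain s t where "p = s @ z # t" by (meson split_list)
    then have "is_path G ((x # y # s @ [z]) @ t)" using assms(2) by simp
    then have "is_path G (x # y # s @ [z])" by (rule is_path_prefix) simp
    then have "is_cycle G (x # y # s @ [z])"
      using assms(3) by (simp add: is_cycle_def insert_commute)
    then show False using assms(1) by blast
  qed
  then show ?thesis using assms by (auto simp: is_path_Cons insert_commute)
qed

section \<open>Leaves\<close>

lemma leaf_neighbour_unique:
  assumes "v \<in> leaves G" "{v, a} \<in> edges G" "{v, b} \<in> edges G"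
  shows "a = b"
proof -
  have "card {e \<in> edges G. v \<in> e} = 1" using assms(1) by (simp add: leaves_def degree_def)
  then obtain e where e: "{e \<in> edges G. v \<in> e} = {e}" by (rule card_1_singletonE)
  have "{v, a} \<in> {e \<in> edges G. v \<in> e}" "{v, b} \<in> {e \<in> edges G. v \<in> e}"
    using assms by simp_all
  then have "{v, a} = {v, b}" unfolding e by simp
  then show ?thesis by (auto simp: doubleton_eq_iff)
qed

text \<open>The known neighbour \<open>a\<close> excludes degree 0, which the complement of
  \<open>leaves\<close> still admits.\<close>

lemma nonleaf_other_neighbour:
  assumes "simple_graph G" "v \<in> verts G - leaves G" "{v, a} \<in> edges G"
  obtains b where "{v, b} \<in> edges G" "b \<noteq> a"
proof -
  let ?I = "{e \<in> edges G. v \<in> e}"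
  have "?I \<noteq> {{v, a}}"
  proof
    assume "?I = {{v, a}}"
    then have "degree G v = 1" unfolding degree_def by simp
    then show False using assms(2) by (simp add: leaves_def)
  qed
  then obtain e where e: "e \<in> edges G" "v \<in> e" "e \<noteq> {v, a}" using assms(3) by blast
  then have "card e = 2" using assms(1) by (auto simp: simple_graph_def)
  then obtain b where "e = {v, b}" using e(2) by (auto simp: card_2_iff)
  then show thesis using that e by auto
qed

lemma internal_verts_not_leaves:
  assumes "is_path G p"
  shows "internal_verts p \<subseteq> verts G - leaves G"
proof
  fix v assume v: "v \<in> internal_verts p"
  then have "v \<in> set p"
    unfolding internal_verts_def by (metis in_set_butlastD list.set_sel(2) tl_Nil)
  then have "v \<in> verts G" using assms by (auto simp: is_path_def)
  then show "v \<in> verts G - leaves G"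
    using internal_vertex_neighbours[OF assms v] leaf_neighbour_unique[of v G] by blast
qed

section \<open>Deleting vertices, in particular leaves\<close>

lemma verts_delete_verts [simp]: "verts (delete_verts G S) = verts G - S"
  and edges_delete_verts [simp]: "edges (delete_verts G S) = {e \<in> edges G. e \<inter> S = {}}"
  by (simp_all add: delete_verts_def)

lemma simple_graph_delete_verts:
  assumes "simple_graph G"
  shows "simple_graph (delete_verts G S)"
proof -
  have "e \<subseteq> verts G - S" if "e \<in> edges G" "e \<inter> S = {}" for e
    using assms that by (auto simp: simple_graph_def)
  then show ?thesis using assms by (simp add: simple_graph_def)
qed

lemma is_path_delete_verts: "is_path (delete_verts G S) p \<longleftrightarrow> is_path G p \<and> set p \<inter> S = {}"
proof -
  have "successively (\<lambda>x y. {x, y} \<in> edges (delete_verts G S)) p \<longleftrightarrow>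
      successively (\<lambda>x y. {x, y} \<in> edges G) p" if "set p \<inter> S = {}"
    using that by (intro successively_cong) auto
  then show ?thesis by (auto simp: is_path_iff)
qed

lemma is_cycle_delete_leaves: "is_cycle (delete_verts G (leaves G)) p \<longleftrightarrow> is_cycle G p"
proof
  assume "is_cycle (delete_verts G (leaves G)) p"
  then show "is_cycle G p" by (simp add: is_cycle_def is_path_delete_verts)
next
  assume p: "is_cycle G p"
  have "set p \<inter> leaves G = {}"
    using cycle_vertex_neighbours[OF p] leaf_neighbour_unique[of _ G] by blast
  moreover have "last p \<in> set p" "hd p \<in> set p"
    using p by (auto simp: is_cycle_def is_path_iff)
  ultimately show "is_cycle (delete_verts G (leaves G)) p"
    using p by (auto simp: is_cycle_def is_path_delete_verts)
qed

lemma path_verts: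
  assumes "path_between G u p v"
  shows "set p \<subseteq> {u, v} \<union> internal_verts p"
proof -
  obtain q where p: "p = u # q" using assms by (cases p) (auto simp: path_between_def is_path_def)
  then show ?thesis
    using assms by (cases q rule: rev_cases) (auto simp: path_between_def internal_verts_def)
qed

text \<open>Paths between non-leaves and all cycles avoid the leaves, so both survive the deletion.
  The nonemptiness condition excludes the single edge, a tree in which every vertex is a
  leaf.\<close>

lemma is_tree_delete_leaves:
  assumes "simple_graph G" "connected_graph G"
  shows "is_tree (delete_verts G (leaves G)) \<longleftrightarrow> is_tree G \<and> verts G - leaves G \<noteq> {}"
proof -
  let ?H = "delete_verts G (leaves G)"
  have "connected_graph ?H" if ne: "verts G - leaves G \<noteq> {}"
    unfolding connected_graph_def
  proof (intro conjI ballI)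
    fix u v assume uv: "u \<in> verts ?H" "v \<in> verts ?H"
    then obtain p where p: "path_between G u p v" using assms(2) by (auto simp: connected_graph_def)
    then have "internal_verts p \<subseteq> verts G - leaves G"
      by (intro internal_verts_not_leaves) (simp add: path_between_def)
    then have "set p \<inter> leaves G = {}" using path_verts[OF p] uv by auto
    then have "path_between ?H u p v" using p by (simp add: path_between_def is_path_delete_verts)
    then show "\<exists>p. path_between ?H u p v" by blast
  qed (use ne in simp)
  moreover have "verts G - leaves G \<noteq> {}" if "connected_graph ?H"
    using that by (simp add: connected_graph_def)
  ultimately show ?thesis
    using assms simple_graph_delete_verts[OF assms(1), of "leaves G"]
    by (auto simp: is_tree_def is_cycle_delete_leaves)
qed

section \<open>Counting edges\<close>

text \<open>Lengths of lists count vertices, so this is the usual distance plus one wherever a path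
  exists.\<close>

definition dist_to :: "'a ugraph \<Rightarrow> 'a \<Rightarrow> 'a \<Rightarrow> nat" where
  "dist_to G r v = (LEAST k. \<exists>p. path_between G v p r \<and> length p = k)"

lemma dist_to_le: "path_between G v p r \<Longrightarrow> dist_to G r v \<le> length p"
  unfolding dist_to_def by (rule Least_le) blast

lemma shortest_path:
  assumes "connected_graph G" "v \<in> verts G" "r \<in> verts G"
  obtains p where "path_between G v p r" "length p = dist_to G r v"
proof -
  have "\<exists>k p. path_between G v p r \<and> length p = k"
    using assms by (auto simp: connected_graph_def)
  then have "\<exists>p. path_between G v p r \<and> length p = dist_to G r v"
    unfolding dist_to_def by (rule LeastI_ex)
  then show thesis using that by blast
qed

lemma closer_neighbour:
  assumes "connected_graph G" "v \<in> verts G" "r \<in> verts G" "v \<noteq> r"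
  obtains w where "{v, w} \<in> edges G" "dist_to G r w < dist_to G r v"
proof -
  obtain p where p: "path_between G v p r" "length p = dist_to G r v"
    using shortest_path assms by metis
  then obtain q where q: "p = v # q" by (cases p) (auto simp: path_between_def is_path_def)
  then have "q \<noteq> []" using p assms(4) by (auto simp: path_between_def)
  then have "{v, hd q} \<in> edges G" "path_between G (hd q) q r"
    using p q by (auto simp: path_between_def is_path_Cons)
  moreover have "length q < dist_to G r v" using p q by simp
  ultimately show thesis using that dist_to_le by (metis order_le_less_trans)
qed

text \<open>In a connected simple graph, joining each vertex other than \<open>r\<close> to its
  parent yields a breadth-first spanning tree rooted at \<open>r\<close>.\<close>

definition parent :: "'a ugraph \<Rightarrow> 'a \<Rightarrow> 'a \<Rightarrow> 'a" where
  "parent G r v = (SOME w. {v, w} \<in> edges G \<and> dist_to G r w < dist_to G r v)"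

lemma parent:
  assumes "connected_graph G" "r \<in> verts G" "v \<in> verts G - {r}"
  shows "{v, parent G r v} \<in> edges G" "dist_to G r (parent G r v) < dist_to G r v"
proof -
  have "\<exists>w. {v, w} \<in> edges G \<and> dist_to G r w < dist_to G r v"
    using closer_neighbour assms by (metis DiffE singletonI)
  then have "{v, parent G r v} \<in> edges G \<and> dist_to G r (parent G r v) < dist_to G r v"
    unfolding parent_def by (rule someI_ex)
  then show "{v, parent G r v} \<in> edges G" "dist_to G r (parent G r v) < dist_to G r v" by auto
qed

definition parent_edges :: "'a ugraph \<Rightarrow> 'a \<Rightarrow> 'a set set" where
  "parent_edges G r = (\<lambda>v. {v, parent G r v}) ` (verts G - {r})"

lemma parent_edges_subset:
  assumes "connected_graph G" "r \<in> verts G"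
  shows "parent_edges G r \<subseteq> edges G"
  using parent[OF assms] by (auto simp: parent_edges_def)

text \<open>Two vertices sharing a parent edge would be parents of each other, each strictly closer
  to \<open>r\<close> than the other.\<close>

lemma card_parent_edges:
  assumes "connected_graph G" "r \<in> verts G"
  shows "card (parent_edges G r) = order G - 1"
proof -
  have "inj_on (\<lambda>v. {v, parent G r v}) (verts G - {r})"
  proof (rule inj_onI)
    fix v w
    assume vw: "v \<in> verts G - {r}" "w \<in> verts G - {r}"
      and eq: "{v, parent G r v} = {w, parent G r w}"
    show "v = w"
    proof (rule ccontr)
      assume "v \<noteq> w"
      then have "v = parent G r w" "w = parent G r v" using eq by (auto simp: doubleton_eq_iff)
      then show False using parent(2)[OF assms vw(1)] parent(2)[OF assms vw(2)] by simp
    qed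
  qed
  then show ?thesis
    using assms(2) by (simp add: parent_edges_def card_image order_def card_Diff_singleton)
qed

lemma order_le_num_edges:
  assumes "simple_graph G" "connected_graph G"
  shows "order G - 1 \<le> num_edges G"
proof -
  obtain r where "r \<in> verts G" using assms(2) by (auto simp: connected_graph_def)
  then show ?thesis
    using card_mono[OF finite_edges[OF assms(1)] parent_edges_subset[OF assms(2)]]
      card_parent_edges[OF assms(2)] by (simp add: num_edges_def)
qed

text \<open>A shortest path from \<open>y\<close> cannot meet \<open>x\<close>: its part from
  \<open>x\<close> on would make \<open>x\<close> strictly closer to \<open>r\<close> than
  \<open>y\<close>. So \<open>x\<close> can be put in front of it.\<close>

lemma extended_shortest_path:
  assumes "simple_graph G" "connected_graph G" "r \<in> verts G"
    and "{x, y} \<in> edges G" "dist_to G r y \<le> dist_to G r x"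
  obtains q where "path_between G x (x # q) r" "q \<noteq> []" "hd q = y"
proof -
  note xy = simple_graph_edgeD[OF assms(1,4)]
  obtain q where q: "path_between G y q r" "length q = dist_to G r y"
    using shortest_path[OF assms(2) xy(2) assms(3)] by blast
  have "x \<notin> set q"
  proof
    assume "x \<in> set q"
    then obtain s t where st: "q = s @ x # t" by (meson split_list)
    then have "path_between G x (x # t) r"
      using q(1) is_path_suffix[of G s "x # t"] by (auto simp: path_between_def)
    then have "dist_to G r x \<le> length (x # t)" by (rule dist_to_le)
    moreover have "s \<noteq> []" using st q(1) xy(3) by (auto simp: path_between_def)
    ultimately show False using assms(5) q(2) st by (cases s) auto
  qed
  moreover have q_hd: "q \<noteq> []" "hd q = y" using q(1) by (auto simp: path_between_def is_path_def)
  ultimately have "path_between G x (x # q) r"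
    using q(1) assms(4) xy(1) by (simp add: path_between_def is_path_Cons)
  then show thesis using q_hd by (rule that)
qed

text \<open>Name the ends of an edge so that \<open>y\<close> is not farther from \<open>r\<close>
  than \<open>x\<close>. One path from \<open>x\<close> to \<open>r\<close> begins with
  \<open>y\<close> and another with the parent of \<open>x\<close>; uniqueness of paths identifies
  the two.\<close>

lemma acyclic_edges_subset_parent_edges:
  assumes "simple_graph G" "connected_graph G" "r \<in> verts G" "\<nexists>p. is_cycle G p"
  shows "edges G \<subseteq> parent_edges G r"
proof -
  have main: "{x, y} \<in> parent_edges G r"
    if xy: "{x, y} \<in> edges G" "dist_to G r y \<le> dist_to G r x" for x y
  proof -
    obtain q where q: "path_between G x (x # q) r" "q \<noteq> []" "hd q = y"
      using extended_shortest_path[OF assms(1-3) xy] by blast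
    \<comment> \<open>The root is the last vertex of \<open>q\<close>, and \<open>x\<close> does not
      occur in \<open>q\<close>.\<close>
    then have x: "x \<in> verts G - {r}"
      using last_in_set[of q] by (auto simp: path_between_def is_path_iff)
    obtain q' where q': "path_between G x (x # q') r" "q' \<noteq> []" "hd q' = parent G r x"
      using extended_shortest_path[OF assms(1-3)] parent[OF assms(2,3) x] by (metis less_imp_le)
    have "x # q = x # q'" using unique_path[OF assms(4) q(1) q'(1)] .
    then have "y = parent G r x" using q q' by simp
    then show ?thesis using x by (auto simp: parent_edges_def)
  qed
  show ?thesis
  proof
    fix e assume e: "e \<in> edges G"
    then obtain x y where "e = {x, y}"
      using assms(1) by (auto simp: simple_graph_def card_2_iff)
    then show "e \<in> parent_edges G r"
      using e main[of x y] main[of y x] by (metis insert_commute linear)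
  qed
qed

text \<open>A vertex of a cycle that is farthest from the root would have two parents.\<close>

lemma parent_edges_acyclic:
  assumes "connected_graph G" "r \<in> verts G" "edges G = parent_edges G r"
  shows "\<nexists>p. is_cycle G p"
proof
  assume "\<exists>p. is_cycle G p"
  then obtain p where p: "is_cycle G p" by blast
  then have "set p \<noteq> {}" by (auto simp: is_cycle_def)
  then have "Max (dist_to G r ` set p) \<in> dist_to G r ` set p" by (intro Max_in) auto
  then obtain v where v: "v \<in> set p" "dist_to G r v = Max (dist_to G r ` set p)" by auto
  have neighbour: "w = parent G r v" if w: "w \<in> set p" "{v, w} \<in> edges G" for w
  proof -
    obtain u where u: "u \<in> verts G - {r}" "{v, w} = {u, parent G r u}"
      using w(2) assms(3) by (auto simp: parent_edges_def)
    have "dist_to G r w \<le> dist_to G r v" using v w by simp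
    \<comment> \<open>If \<open>u = w\<close>, then \<open>v\<close> would be the parent of
      \<open>w\<close> and strictly closer to the root; hence \<open>u = v\<close>.\<close>
    then show ?thesis
      using u parent(2)[OF assms(1,2) u(1)] by (auto simp: doubleton_eq_iff)
  qed
  obtain a b where "a \<in> set p" "b \<in> set p" "{v, a} \<in> edges G" "{v, b} \<in> edges G" "a \<noteq> b"
    using cycle_vertex_neighbours[OF p v(1)] .
  then show False using neighbour by metis
qed

text \<open>The parent edges form a subset of the finite edge set with \<open>order G - 1\<close>
  elements, so the count is attained exactly when they are all the edges.\<close>

lemma is_tree_iff_num_edges:
  assumes "simple_graph G" "connected_graph G"
  shows "is_tree G \<longleftrightarrow> num_edges G = order G - 1"
proof -
  obtain r where r: "r \<in> verts G" using assms(2) by (auto simp: connected_graph_def)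
  have sub: "parent_edges G r \<subseteq> edges G" using parent_edges_subset[OF assms(2) r] .
  have card: "card (parent_edges G r) = order G - 1" using card_parent_edges[OF assms(2) r] .
  have "num_edges G = order G - 1 \<longleftrightarrow> edges G = parent_edges G r"
    using card_subset_eq[OF finite_edges[OF assms(1)] sub] card by (auto simp: num_edges_def)
  moreover have "edges G = parent_edges G r \<longleftrightarrow> (\<nexists>p. is_cycle G p)"
    using sub acyclic_edges_subset_parent_edges[OF assms r] parent_edges_acyclic[OF assms(2) r]
    by blast
  ultimately show ?thesis using assms by (simp add: is_tree_def)
qed

section \<open>Rainbow colourings\<close>

lemma rvc_le:
  assumes "c ` verts G \<subseteq> {..<i}" "rainbow_vertex_connected G c"
  shows "rvc G \<le> i"
  unfolding rvc_def using assms by (intro Least_le) blast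

text \<open>All leaves share colour 0 with some non-leaf; \<open>max 1\<close> keeps that colour
  available when there is no non-leaf.\<close>

lemma nonleaf_colouring:
  assumes "simple_graph G" "connected_graph G"
  obtains c where "c ` verts G \<subseteq> {..<max 1 (card (verts G - leaves G))}"
    and "rainbow_vertex_connected G c"
proof -
  let ?N = "verts G - leaves G"
  have "finite ?N" using assms(1) by (simp add: simple_graph_def)
  then obtain f where f: "bij_betw f ?N {0..<card ?N}" using ex_bij_betw_finite_nat by blast
  define c where "c v = (if v \<in> ?N then f v else 0)" for v
  have "inj_on c ?N" using f by (auto simp: c_def bij_betw_def inj_on_def)
  then have inj: "inj_on c (internal_verts p)" if "is_path G p" for p
    using internal_verts_not_leaves[OF that] by (rule inj_on_subset)
  have "rainbow_vertex_connected G c"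
    unfolding rainbow_vertex_connected_def
  proof (intro ballI impI)
    fix u v assume "u \<in> verts G" "v \<in> verts G"
    then obtain p where "path_between G u p v" using assms(2) by (auto simp: connected_graph_def)
    then have "rainbow_path G c u p v"
      using inj by (auto simp: rainbow_path_def path_between_def)
    then show "\<exists>p. rainbow_path G c u p v" by blast
  qed
  moreover have "f v < card ?N" if "v \<in> ?N" for v
    using bij_betwE[OF f] that by simp
  then have "c ` verts G \<subseteq> {..<max 1 (card ?N)}"
    by (fastforce simp: c_def less_max_iff_disj)
  ultimately show thesis using that by blast
qed

lemma tree_rainbow_inj_on_nonleaves:
  assumes "is_tree G" "rainbow_vertex_connected G c"
  shows "inj_on c (verts G - leaves G)"
proof (rule inj_onI, rule ccontr)
  fix x y
  assume x: "x \<in> verts G - leaves G" and y: "y \<in> verts G - leaves G"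
    and eq: "c x = c y" and "x \<noteq> y"
  have simple: "simple_graph G" and conn: "connected_graph G" and acyclic: "\<nexists>p. is_cycle G p"
    using assms(1) by (auto simp: is_tree_def)
  obtain p where p: "path_between G x p y"
    using conn x y unfolding connected_graph_def by blast
  then obtain a s where xa: "p = x # a # s"
    using path_between_two_vertices \<open>x \<noteq> y\<close> by metis
  have "{x, a} \<in> edges G" using p xa by (auto simp: path_between_def is_path_Cons)
  \<comment> \<open>The path leaves \<open>x\<close> through \<open>a\<close>, so a second neighbour
    of \<open>x\<close> prolongs it beyond \<open>x\<close>.\<close>
  then obtain x' where x': "{x, x'} \<in> edges G" "x' \<noteq> a"
    using nonleaf_other_neighbour[OF simple x] by metis
  then have xp: "is_path G (x' # p)"
    using extend_path[OF acyclic, of x a s x'] p xa simple_graph_edgeD[OF simple x'(1)]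
    by (auto simp: path_between_def)
  \<comment> \<open>Reversal brings \<open>y\<close> to the front, where \<open>extend_path\<close>
    applies.\<close>
  obtain b t where yb: "rev p = y # b # t"
    using path_between_two_vertices[OF path_between_rev[OF p]] \<open>x \<noteq> y\<close> by metis
  have rev_path: "is_path G (y # b # t @ [x'])"
    using xp yb is_path_rev[of G "x' # p"] by simp
  then have "{y, b} \<in> edges G" by (auto simp: is_path_Cons)
  then obtain y' where y': "{y, y'} \<in> edges G" "y' \<noteq> b"
    using nonleaf_other_neighbour[OF simple y] by metis
  then have "is_path G (y' # y # b # t @ [x'])"
    using extend_path[OF acyclic rev_path y'(1)] simple_graph_edgeD[OF simple y'(1)] by auto
  then have ext_path: "is_path G (y' # rev p @ [x'])" using yb by simp
  then have ext: "path_between G y' (y' # rev p @ [x']) x'" by (simp add: path_between_def)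
  have "y' \<noteq> x'" "y' \<in> verts G" "x' \<in> verts G" using ext_path by (auto simp: is_path_iff)
  then obtain q where q: "path_between G y' q x'" "inj_on c (internal_verts q)"
    using assms(2) unfolding rainbow_vertex_connected_def rainbow_path_def by blast
  \<comment> \<open>Both ends of the extended path are outside \<open>p\<close>, so its internal
    vertices are exactly \<open>set p\<close>, including \<open>x\<close> and
    \<open>y\<close>.\<close>
  then have "q = y' # rev p @ [x']" using unique_path[OF acyclic] ext by blast
  then have "inj_on c (set p)" using q(2) by (simp add: internal_verts_def)
  moreover have "x \<in> set p" "y \<in> set p"
    using p last_in_set[of p] by (auto simp: path_between_def is_path_def)
  ultimately show False using eq \<open>x \<noteq> y\<close> by (auto dest: inj_onD)
qed

lemma rvc_tree:
  assumes "is_tree G"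
  shows "card (verts G - leaves G) \<le> rvc G" "rvc G \<le> max 1 (card (verts G - leaves G))"
proof -
  have simple: "simple_graph G" and conn: "connected_graph G"
    using assms by (auto simp: is_tree_def)
  obtain c where c: "c ` verts G \<subseteq> {..<max 1 (card (verts G - leaves G))}"
    "rainbow_vertex_connected G c"
    using nonleaf_colouring[OF simple conn] .
  then show "rvc G \<le> max 1 (card (verts G - leaves G))" by (rule rvc_le)
  \<comment> \<open>The \<open>LEAST\<close> in \<open>rvc\<close> is attained only if some
    colouring qualifies.\<close>
  have "\<exists>i c. c ` verts G \<subseteq> {..<i} \<and> rainbow_vertex_connected G c" using c by blast
  then have "\<exists>c. c ` verts G \<subseteq> {..<rvc G} \<and> rainbow_vertex_connected G c"
    unfolding rvc_def by (rule LeastI_ex)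
  then obtain c' where c': "c' ` verts G \<subseteq> {..<rvc G}" "rainbow_vertex_connected G c'" by blast
  have "c' ` (verts G - leaves G) \<subseteq> {..<rvc G}" using c'(1) by blast
  then have "card (verts G - leaves G) \<le> card {..<rvc G}"
    using tree_rainbow_inj_on_nonleaves[OF assms c'(2)] by (intro card_inj_on_le) auto
  then show "card (verts G - leaves G) \<le> rvc G" by simp
qed

text \<open>For \<open>d > 1\<close> the \<open>max 1\<close> in the upper bound has no effect, and
  the two bounds agree.\<close>

lemma rvc_tree_eq_iff:
  assumes "is_tree G" "1 < d"
  shows "rvc G = d \<longleftrightarrow> card (verts G - leaves G) = d"
  using rvc_tree[OF assms(1)] assms(2) by (auto simp: max_def split: if_splits)

section \<open>Caterpillars\<close>

text \<open>The spine is \<open>0, \<dots>, d + 1\<close>, and the remaining vertices are pendant at \<open>1\<close>.\<close>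

definition caterpillar_parent :: "nat \<Rightarrow> nat \<Rightarrow> nat" where
  "caterpillar_parent d i = (if i \<le> Suc d then i - 1 else 1)"

text \<open>Each edge is indexed by its larger end, which makes the edge count immediate.\<close>

definition caterpillar :: "nat \<Rightarrow> nat \<Rightarrow> nat ugraph" where
  "caterpillar d n = UGraph {..<n} ((\<lambda>i. {i, caterpillar_parent d i}) ` {0<..<n})"

lemma caterpillar_parent_less: "0 < i \<Longrightarrow> caterpillar_parent d i < i"
  by (auto simp: caterpillar_parent_def)

lemma verts_caterpillar [simp]: "verts (caterpillar d n) = {..<n}"
  by (simp add: caterpillar_def)

lemma edges_caterpillar:
  "edges (caterpillar d n) = (\<lambda>i. {i, caterpillar_parent d i}) ` {0<..<n}"
  by (simp add: caterpillar_def)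

lemma simple_caterpillar: "simple_graph (caterpillar d n)"
proof -
  have "{i, caterpillar_parent d i} \<subseteq> {..<n} \<and> card {i, caterpillar_parent d i} = 2"
    if "0 < i" "i < n" for i
    using caterpillar_parent_less[of i d] that by (auto simp: card_2_iff)
  then show ?thesis by (auto simp: simple_graph_def edges_caterpillar)
qed

text \<open>From \<open>u\<close>, parents lead down to 0, and the same kind of edges leads up to
  any \<open>v\<close>. Both inductions fix the start \<open>u\<close> and move only the end, so
  paths need not be concatenated.\<close>

lemma connected_caterpillar:
  assumes "0 < n"
  shows "connected_graph (caterpillar d n)"
proof -
  let ?G = "caterpillar d n"
  have edge: "{i, caterpillar_parent d i} \<in> edges ?G" if "0 < i" "i < n" for i
    using that by (auto simp: edges_caterpillar)
  have down: "\<exists>p. path_between ?G u p 0" if "path_between ?G u p v" for u p v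
    using that
  proof (induction v arbitrary: p rule: less_induct)
    case (less v)
    show ?case
    proof (cases "v = 0")
      case False
      have "v < n" using less.prems last_in_set[of p] by (auto simp: path_between_def is_path_def)
      then have "{v, caterpillar_parent d v} \<in> edges ?G" "caterpillar_parent d v \<in> verts ?G"
        using edge False caterpillar_parent_less[of v d] by auto
      then obtain q where "path_between ?G u q (caterpillar_parent d v)"
        using path_snoc_or_prefix[OF less.prems] by blast
      then show ?thesis using less.IH caterpillar_parent_less False by blast
    qed (use less.prems in blast)
  qed
  have up: "\<exists>p. path_between ?G u p v" if u: "\<exists>p. path_between ?G u p 0" and "v < n" for u v
    using that(2)
  proof (induction v rule: less_induct)
    case (less v)
    show ?case
    proof (cases "v = 0")
      case False
      then obtain p where "path_between ?G u p (caterpillar_parent d v)"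
        using less caterpillar_parent_less[of v d] by force
      moreover have "{caterpillar_parent d v, v} \<in> edges ?G"
        using edge[of v] less.prems False by (simp add: insert_commute)
      ultimately show ?thesis
        using path_snoc_or_prefix less.prems by (metis lessThan_iff verts_caterpillar)
    qed (use u in blast)
  qed
  have "path_between ?G u [u] u" if "u < n" for u
    using that by (simp add: path_between_def is_path_def)
  then show ?thesis
    unfolding connected_graph_def using assms down up
    by (metis lessThan_iff empty_iff verts_caterpillar)
qed

lemma num_edges_caterpillar: "num_edges (caterpillar d n) = n - 1"
proof -
  have "inj_on (\<lambda>i. {i, caterpillar_parent d i}) {0<..<n}"
  proof (rule inj_onI)
    fix i j
    assume "i \<in> {0<..<n}" "j \<in> {0<..<n}"
      and eq: "{i, caterpillar_parent d i} = {j, caterpillar_parent d j}"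
    then have "caterpillar_parent d i < i" "caterpillar_parent d j < j"
      using caterpillar_parent_less by auto
    then show "i = j" using eq by (auto simp: doubleton_eq_iff)
  qed
  then show ?thesis by (simp add: num_edges_def edges_caterpillar card_image)
qed

text \<open>Each of \<open>1, ..., d\<close> has both spine neighbours; \<open>d + 2 \<le> n\<close>
  ensures that \<open>d + 1\<close> is present. Every other vertex lies on a single edge.\<close>

lemma nonleaves_caterpillar:
  assumes "0 < d" "d + 2 \<le> n"
  shows "verts (caterpillar d n) - leaves (caterpillar d n) = {1..d}"
proof -
  let ?G = "caterpillar d n"
  have "v \<notin> leaves ?G" if "v \<in> {1..d}" for v
  proof
    assume "v \<in> leaves ?G"
    moreover have "{v, v - 1} \<in> edges ?G"
      using that assms unfolding edges_caterpillar
      by (intro image_eqI[of _ _ v]) (auto simp: caterpillar_parent_def)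
    moreover have "{v, Suc v} \<in> edges ?G"
      using that assms unfolding edges_caterpillar
      by (intro image_eqI[of _ _ "Suc v"]) (auto simp: caterpillar_parent_def)
    ultimately have "v - 1 = Suc v" by (rule leaf_neighbour_unique)
    then show False by simp
  qed
  moreover have "v \<in> leaves ?G" if "v < n" "v \<notin> {1..d}" for v
  proof -
    \<comment> \<open>Outside \<open>{1..d}\<close> the only parent is 0, and its only child is
      1.\<close>
    have parent: "i = 1 \<and> v = 0" if "caterpillar_parent d i = v" "0 < i" for i
      using that \<open>v \<notin> {1..d}\<close> assms(1) by (auto simp: caterpillar_parent_def split: if_splits)
    have zero: "caterpillar_parent d 1 = 0" by (simp add: caterpillar_parent_def)
    \<comment> \<open>The index of the unique edge at \<open>v\<close>: its own parent edge, or the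
      edge of vertex 1 when \<open>v\<close> is the root 0.\<close>
    define k where "k = (if v = 0 then 1 else v)"
    have "v \<in> {i, caterpillar_parent d i} \<longleftrightarrow> i = k" if "0 < i" for i
      using parent[of i] that zero by (auto simp: k_def)
    then have "{i \<in> {0<..<n}. v \<in> {i, caterpillar_parent d i}} = {i \<in> {0<..<n}. i = k}"
      by (intro Collect_cong) auto
    also have "\<dots> = {k}" using assms \<open>v < n\<close> by (auto simp: k_def)
    finally have k: "{i \<in> {0<..<n}. v \<in> {i, caterpillar_parent d i}} = {k}" .
    have "{e \<in> edges ?G. v \<in> e} =
        (\<lambda>i. {i, caterpillar_parent d i}) ` {i \<in> {0<..<n}. v \<in> {i, caterpillar_parent d i}}"
      unfolding edges_caterpillar by blast
    also have "\<dots> = {{k, caterpillar_parent d k}}" unfolding k by simp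
    finally have "{e \<in> edges ?G. v \<in> e} = {{k, caterpillar_parent d k}}" .
    then have "degree ?G v = 1" unfolding degree_def by simp
    then show ?thesis using that by (simp add: leaves_def)
  qed
  ultimately show ?thesis using assms by fastforce
qed

text \<open>The caterpillar attains the bound that holds for every connected graph, so the infimum
  is a minimum.\<close>

lemma min_edges_eq:
  assumes "1 < d" "d + 2 \<le> n"
  shows "min_edges d n = n - 1"
  unfolding min_edges_def
proof (rule cInf_eq_minimum)
  let ?G = "caterpillar d n"
  have simple: "simple_graph ?G" and conn: "connected_graph ?G"
    using simple_caterpillar connected_caterpillar assms by auto
  have order: "order ?G = n" by (simp add: order_def)
  have "is_tree ?G"
    using is_tree_iff_num_edges[OF simple conn] num_edges_caterpillar order by simp
  then have "rvc ?G = d" using rvc_tree_eq_iff assms nonleaves_caterpillar[of d n] by fastforce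
  then have "?G \<in> graphs_rvc d n" using simple conn order by (simp add: graphs_rvc_def)
  then show "n - 1 \<in> num_edges ` graphs_rvc d n" using num_edges_caterpillar by (metis image_eqI)
next
  fix m assume "m \<in> num_edges ` graphs_rvc d n"
  then show "n - 1 \<le> m" using order_le_num_edges by (auto simp: graphs_rvc_def)
qed

text \<open>The guard \<open>d + 2 \<le> n\<close> belongs to the first claim because
  \<open>graphs_rvc d (d + 1)\<close> is empty, which makes \<open>min_edges d (d + 1)\<close> equal
  to 0.\<close>

theorem theorem4:
  fixes d n :: nat
  assumes "1 < d" and "d < n"
  shows "(d + 2 \<le> n \<longrightarrow> min_edges d n = n - 1) \<and>
    (\<forall>G :: 'a ugraph. simple_graph G \<and> connected_graph G \<and> order G = n \<longrightarrow>
       (rvc G = d \<and> num_edges G = n - 1 \<longleftrightarrow>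
        is_tree (delete_verts G (leaves G)) \<and> order (delete_verts G (leaves G)) = d))"
proof (intro conjI allI impI)
  assume "d + 2 \<le> n"
  then show "min_edges d n = n - 1" using min_edges_eq assms(1) by blast
next
  fix G :: "'a ugraph"
  assume G: "simple_graph G \<and> connected_graph G \<and> order G = n"
  let ?H = "delete_verts G (leaves G)"
  \<comment> \<open>Positive \<open>d\<close> supplies the nonemptiness condition of
    \<open>is_tree_delete_leaves\<close>.\<close>
  have nonleaf: "verts G - leaves G \<noteq> {}" if "order ?H = d"
    using that assms(1) by (intro notI) (simp add: order_def)
  have "rvc G = d \<and> num_edges G = n - 1 \<longleftrightarrow> rvc G = d \<and> is_tree G"
    using is_tree_iff_num_edges G by blast
  also have "\<dots> \<longleftrightarrow> is_tree G \<and> order ?H = d"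
    using rvc_tree_eq_iff[of G d] assms(1) by (auto simp: order_def)
  also have "is_tree G \<and> order ?H = d \<longleftrightarrow> is_tree ?H \<and> order ?H = d"
    using is_tree_delete_leaves[of G] nonleaf G by blast
  finally show "rvc G = d \<and> num_edges G = n - 1 \<longleftrightarrow> is_tree ?H \<and> order ?H = d" .
qed

end
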